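(* Let $R$ be an associative (not necessarily unital or commutative) $\mathbb{F}$-algebra with a homothetic datum $(\sigma,s)$. Let $\alpha_R$ be an algebra endomorphism of $R$, and let $w\in R$ and $\varsigma\in\{0,1\}\subset\mathbb{F}$ be such that for all $a\in R$, (i) $\alpha_R(s)-\varsigma s = w^2+\varsigma\, w\sigma+\varsigma\,\sigma w-w$, (ii) $\alpha_R(a\sigma)=\varsigma\,\alpha_R(a)\sigma+\alpha_R(a)w$, (iii) $\alpha_R(\sigma a)=\varsigma\,\sigma\alpha_R(a)+w\alpha_R(a)$, so that $\alpha_S^\varsigma(a+\xi\boldsymbol{\sigma})=\alpha_R(a)+\xi w+\xi\varsigma\boldsymbol{\sigma}$ is an algebra endomorphism of the homothetic extension $R(\sigma,s)$ extending $\alpha_R$. Let $\delta_R$ be an $\alpha_R$-skew derivation of $R$. Then there exists an $\alpha_S^\varsigma$-skew derivation $\delta_S$ of $R(\sigma,s)$ extending $\delta_R$, i.e. such that $\delta_S\circ\iota=\iota\circ\delta_R$, where $\iota:R\to R(\sigma,s)$, $a\mapsto a+0\boldsymbol{\sigma}$, if and only if there exist $e\in R$ and a scalar $\mu(\varsigma)\in\mathbb{F}$, where $\mu(1)=0$ while $\mu(0)$ may be any scalar, such that for all $a\in R$, (a) $\delta_R(s)-\mu(\varsigma)s=e\sigma+\varsigma\,\sigma e+we+\mu(\varsigma)\,w\sigma-e$, (b) $\delta_R(a\sigma)=\delta_R(a)\sigma+\alpha_R(a)e+\mu(\varsigma)\,\alpha_R(a)\sigma$, (c) $\delta_R(\sigma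 a)=w\delta_R(a)+\varsigma\,\sigma\delta_R(a)+ea+\mu(\varsigma)\,\sigma a$.
   Context: $\mathbb{F}$ denotes a field or the ring of integers $\mathbb{Z}$. Algebras are associative $\mathbb{F}$-algebras, not necessarily unital or commutative; algebra endomorphisms are $\mathbb{F}$-linear multiplicative maps (no unitality required). A double operator $\sigma=(\overleftarrow{\sigma},\overrightarrow{\sigma})$ on $R$ is a pair of $\mathbb{F}$-linear endomorphisms of $R$, written $\overrightarrow{\sigma}(a)=\sigma a$ and $\overleftarrow{\sigma}(a)=a\sigma$. It is a bimultiplication if $\sigma(ab)=(\sigma a)b$, $(ab)\sigma=a(b\sigma)$ and $a(\sigma b)=(a\sigma)b$ for all $a,b\in R$. A bimultiplication is a double homothetism if $\sigma(a\sigma)=(\sigma a)\sigma$ for all $a\in R$. A homothetic datum on $R$ is a pair $(\sigma,s)$ with $\sigma$ a double homothetism and $s\in R$ such that $\sigma s=s\sigma$ and $\sigma^2=\sigma+\bar{s}$, i.e. $\sigma(\sigma a)=\sigma a+sa$ and $(a\sigma)\sigma=a\sigma+as$ for all $a\in R$. The homothetic extension $R(\sigma,s)$ is the $\mathbb{F}$-module $R\oplus\mathbb{F}$, whose elements $(a,\xi)$ are written $a+\xi\boldsymbol{\sigma}$, with the associative multiplication $$(a+\xi\boldsymbol{\sigma})(b+\zeta\boldsymbol{\sigma})=ab+\zeta\, a\sigma+\xi\,\sigma b+\xi\zeta s+\xi\zeta\boldsymbol{\sigma}.$$ For an algebra endomorphism $\alpha$ of an algebra $A$, an $\alpha$-skew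 derivation (or $\alpha$-derivation) of $A$ is an $\mathbb{F}$-linear map $\delta:A\to A$ with $\delta(ab)=\delta(a)b+\alpha(a)\delta(b)$ for all $a,b\in A$. *)

theory Defs
  imports "HOL-Analysis.Product_Vector"
begin

(* The zero ring is excluded by the class comm_ring_1; the second disjunct says
   that the canonical map from the integers is an isomorphism. *)
definition field_or_integers :: "'k::comm_ring_1 itself \<Rightarrow> bool" where
  "field_or_integers _ \<longleftrightarrow>
     (\<forall>x::'k. x \<noteq> 0 \<longrightarrow> x dvd 1) \<or> bij (of_int :: int \<Rightarrow> 'k)"

(* The product is a parameter and not the class operation, because the product
   of a homothetic extension depends on the homothetic datum. *)
locale nonunital_algebra = module smul
  for smul :: "'k::comm_ring_1 \<Rightarrow> 'a::ab_group_add \<Rightarrow> 'a" +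
  fixes mult :: "'a \<Rightarrow> 'a \<Rightarrow> 'a"
  assumes mult_assoc: "mult (mult a b) c = mult a (mult b c)"
    and mult_add_left: "mult (a + b) c = mult a c + mult b c"
    and mult_add_right: "mult a (b + c) = mult a b + mult a c"
    and mult_scale_left: "mult (smul \<xi> a) b = smul \<xi> (mult a b)"
    and mult_scale_right: "mult a (smul \<xi> b) = smul \<xi> (mult a b)"

locale algebra_endomorphism =
  nonunital_algebra smul mult + module_hom smul smul \<alpha>
  for smul :: "'k::comm_ring_1 \<Rightarrow> 'a::ab_group_add \<Rightarrow> 'a"
    and mult :: "'a \<Rightarrow> 'a \<Rightarrow> 'a"
    and \<alpha> :: "'a \<Rightarrow> 'a" +
  assumes hom_mult: "\<alpha> (mult a b) = mult (\<alpha> a) (\<alpha> b)"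

locale skew_derivation =
  algebra_endomorphism smul mult \<alpha> + \<delta>: module_hom smul smul \<delta>
  for smul :: "'k::comm_ring_1 \<Rightarrow> 'a::ab_group_add \<Rightarrow> 'a"
    and mult :: "'a \<Rightarrow> 'a \<Rightarrow> 'a"
    and \<alpha> :: "'a \<Rightarrow> 'a"
    and \<delta> :: "'a \<Rightarrow> 'a" +
  assumes skew_Leibniz: "\<delta> (mult a b) = mult (\<delta> a) b + mult (\<alpha> a) (\<delta> b)"

(* The components are in the order of the arrows: the first one is
   a \<mapsto> a\<sigma>, the second one is a \<mapsto> \<sigma>a. *)
type_synonym 'r double_operator = "('r \<Rightarrow> 'r) \<times> ('r \<Rightarrow> 'r)"

abbreviation (input) right_act :: "'r \<Rightarrow> 'r double_operator \<Rightarrow> 'r"  (infixl "\<lhd>" 80) where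
  "a \<lhd> \<sigma> \<equiv> fst \<sigma> a"

abbreviation (input) left_act :: "'r double_operator \<Rightarrow> 'r \<Rightarrow> 'r"  (infixr "\<rhd>" 80) where
  "\<sigma> \<rhd> a \<equiv> snd \<sigma> a"

definition double_operator ::
    "('k::comm_ring_1 \<Rightarrow> 'r::ring \<Rightarrow> 'r) \<Rightarrow> 'r double_operator \<Rightarrow> bool" where
  "double_operator smul \<sigma> \<longleftrightarrow>
     module_hom smul smul (fst \<sigma>) \<and> module_hom smul smul (snd \<sigma>)"

definition bimultiplication ::
    "('k::comm_ring_1 \<Rightarrow> 'r::ring \<Rightarrow> 'r) \<Rightarrow> 'r double_operator \<Rightarrow> bool" where
  "bimultiplication smul \<sigma> \<longleftrightarrow> double_operator smul \<sigma> \<and>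
     (\<forall>a b. \<sigma> \<rhd> (a * b) = (\<sigma> \<rhd> a) * b \<and>
            (a * b) \<lhd> \<sigma> = a * (b \<lhd> \<sigma>) \<and>
            a * (\<sigma> \<rhd> b) = (a \<lhd> \<sigma>) * b)"

definition double_homothetism ::
    "('k::comm_ring_1 \<Rightarrow> 'r::ring \<Rightarrow> 'r) \<Rightarrow> 'r double_operator \<Rightarrow> bool" where
  "double_homothetism smul \<sigma> \<longleftrightarrow> bimultiplication smul \<sigma> \<and>
     (\<forall>a. \<sigma> \<rhd> (a \<lhd> \<sigma>) = (\<sigma> \<rhd> a) \<lhd> \<sigma>)"

definition homothetic_datum ::
    "('k::comm_ring_1 \<Rightarrow> 'r::ring \<Rightarrow> 'r) \<Rightarrow> 'r double_operator \<Rightarrow> 'r \<Rightarrow> bool" where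
  "homothetic_datum smul \<sigma> s \<longleftrightarrow> double_homothetism smul \<sigma> \<and>
     \<sigma> \<rhd> s = s \<lhd> \<sigma> \<and>
     (\<forall>a. \<sigma> \<rhd> (\<sigma> \<rhd> a) = \<sigma> \<rhd> a + s * a \<and>
          (a \<lhd> \<sigma>) \<lhd> \<sigma> = a \<lhd> \<sigma> + a * s)"

(* The pair (a, \<xi>) stands for the element a + \<xi>\<sigma> of R(\<sigma>, s). *)
abbreviation hext_scale ::
    "('k::comm_ring_1 \<Rightarrow> 'r::ring \<Rightarrow> 'r) \<Rightarrow> 'k \<Rightarrow> 'r \<times> 'k \<Rightarrow> 'r \<times> 'k" where
  "hext_scale smul \<equiv> module_prod.scale smul (*)"

definition hext_mult ::
    "('k::comm_ring_1 \<Rightarrow> 'r::ring \<Rightarrow> 'r) \<Rightarrow> 'r double_operator \<Rightarrow> 'r \<Rightarrow>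
     'r \<times> 'k \<Rightarrow> 'r \<times> 'k \<Rightarrow> 'r \<times> 'k" where
  "hext_mult smul \<sigma> s = (\<lambda>(a, \<xi>) (b, \<zeta>).
     (a * b + smul \<zeta> (a \<lhd> \<sigma>) + smul \<xi> (\<sigma> \<rhd> b) + smul (\<xi> * \<zeta>) s, \<xi> * \<zeta>))"

definition hext_embed :: "'r::ring \<Rightarrow> 'r \<times> 'k::comm_ring_1" where
  "hext_embed a = (a, 0)"

definition hext_endo ::
    "('k::comm_ring_1 \<Rightarrow> 'r::ring \<Rightarrow> 'r) \<Rightarrow> ('r \<Rightarrow> 'r) \<Rightarrow> 'r \<Rightarrow> 'k \<Rightarrow>
     'r \<times> 'k \<Rightarrow> 'r \<times> 'k" where
  "hext_endo smul \<alpha> w \<epsilon> = (\<lambda>(a, \<xi>). (\<alpha> a + smul \<xi> w, \<xi> * \<epsilon>))"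

lemma module_times: "module ((*) :: 'k::comm_ring_1 \<Rightarrow> 'k \<Rightarrow> 'k)"
  by unfold_locales (auto simp: algebra_simps)

lemma module_prod_times:
  assumes "module (smul :: 'k::comm_ring_1 \<Rightarrow> 'r::ring \<Rightarrow> 'r)"
  shows "module_prod smul ((*) :: 'k \<Rightarrow> 'k \<Rightarrow> 'k)"
  using assms module_times by (simp add: module_prod_def module_pair_def)

lemma hext_nonunital_algebra:
  fixes smul :: "'k::comm_ring_1 \<Rightarrow> 'r::ring \<Rightarrow> 'r"
  assumes alg: "nonunital_algebra smul (*)" and datum: "homothetic_datum smul \<sigma> s"
  shows "nonunital_algebra (hext_scale smul) (hext_mult smul \<sigma> s)"
proof -
  interpret A: nonunital_algebra smul "(*)" by fact
  interpret P: module_prod smul "(*) :: 'k \<Rightarrow> 'k \<Rightarrow> 'k"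
    by (rule module_prod_times) (rule A.module_axioms)
  have op: "double_operator smul \<sigma>"
    using datum by (simp add: homothetic_datum_def double_homothetism_def bimultiplication_def)
  interpret r: module_hom smul smul "fst \<sigma>" using op by (simp add: double_operator_def)
  interpret l: module_hom smul smul "snd \<sigma>" using op by (simp add: double_operator_def)
  have act: "\<sigma> \<rhd> (a * b) = (\<sigma> \<rhd> a) * b" "(a * b) \<lhd> \<sigma> = a * (b \<lhd> \<sigma>)"
      "(a \<lhd> \<sigma>) * b = a * (\<sigma> \<rhd> b)" "\<sigma> \<rhd> (a \<lhd> \<sigma>) = (\<sigma> \<rhd> a) \<lhd> \<sigma>"
      "s \<lhd> \<sigma> = \<sigma> \<rhd> s" "\<sigma> \<rhd> (\<sigma> \<rhd> a) = \<sigma> \<rhd> a + s * a"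
      "(a \<lhd> \<sigma>) \<lhd> \<sigma> = a \<lhd> \<sigma> + a * s" for a b
    using datum
    unfolding homothetic_datum_def double_homothetism_def bimultiplication_def by metis+
  note simps = hext_mult_def P.scale_def act r.add l.add r.scale l.scale
    A.scale_right_distrib A.scale_left_distrib A.mult_scale_left A.mult_scale_right
    distrib_left distrib_right A.scale_scale
  show ?thesis
  proof unfold_locales
    fix x y z :: "'r \<times> 'k" and c :: 'k
    obtain a \<xi> b \<zeta> d \<eta> where xyz: "x = (a, \<xi>)" "y = (b, \<zeta>)" "z = (d, \<eta>)"
      by (metis surj_pair)
    show "hext_mult smul \<sigma> s (hext_mult smul \<sigma> s x y) z =
        hext_mult smul \<sigma> s x (hext_mult smul \<sigma> s y z)"
      by (simp only: xyz prod.case prod.inject simps ac_simps)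
    show "hext_mult smul \<sigma> s (x + y) z = hext_mult smul \<sigma> s x z + hext_mult smul \<sigma> s y z"
      by (simp only: xyz prod.case prod.inject add_Pair fst_conv snd_conv simps ac_simps)
    show "hext_mult smul \<sigma> s x (y + z) = hext_mult smul \<sigma> s x y + hext_mult smul \<sigma> s x z"
      by (simp only: xyz prod.case prod.inject add_Pair fst_conv snd_conv simps ac_simps)
    show "hext_mult smul \<sigma> s (hext_scale smul c x) y = hext_scale smul c (hext_mult smul \<sigma> s x y)"
      by (simp only: xyz prod.case prod.inject add_Pair fst_conv snd_conv simps ac_simps)
    show "hext_mult smul \<sigma> s x (hext_scale smul c y) = hext_scale smul c (hext_mult smul \<sigma> s x y)"
      by (simp only: xyz prod.case prod.inject add_Pair fst_conv snd_conv simps ac_simps)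
  qed
qed

end

theory Submission
  imports Defs
begin

text \<open>
  As a module, \<open>R(\<sigma>, s)\<close> is spanned by \<open>R\<close> and the single extra generator \<open>\<sigma> = (0, 1)\<close>. A
  linear map that carries \<open>R\<close> to itself by \<open>f\<close> is therefore determined by the image
  \<open>(u, \<nu>)\<close> of \<open>\<sigma>\<close>, and it is the map \<open>(a, \<xi>) \<mapsto> (f a + \<xi> u, \<xi> \<nu>)\<close>
  (\<open>linear_extension_eq_hext_endo\<close>). So \<open>\<alpha>\<^sub>S\<close> is given by \<open>\<alpha>\<^sub>R\<close> with \<open>\<alpha>\<^sub>S \<sigma> = (w, \<epsilon>)\<close>, and
  the only unknown in \<open>\<delta>\<^sub>S\<close> is \<open>\<delta>\<^sub>S \<sigma> = (e, \<mu>)\<close>.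

  Both sides of the skew Leibniz rule are bilinear, so the rule needs to be compared only on
  the four kinds of products of generators. The products \<open>ab\<close> give the rule in \<open>R\<close>, the products
  \<open>a\<sigma>\<close> give (b), the products \<open>\<sigma>a\<close> give (c), and \<open>\<sigma>\<sigma> = s + \<sigma>\<close> gives (a) in the component \<open>R\<close>
  and \<open>\<epsilon>\<mu> = 0\<close> in the scalar component (\<open>hext_skew_Leibniz_iff\<close>). For \<open>\<epsilon> \<in> {0, 1}\<close> the
  equation \<open>\<epsilon>\<mu> = 0\<close> is the restriction on \<open>\<mu>\<close> in the theorem.

  That \<open>\<alpha>\<^sub>S\<close> is multiplicative is an instance of the same computation: a linear map \<open>\<alpha>\<close> is
  multiplicative if and only if \<open>\<alpha> - id\<close> satisfies the \<open>\<alpha>\<close>-skew Leibniz rule, because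
  \<open>\<alpha>(a) \<alpha>(b) - a b = (\<alpha>(a) - a) b + \<alpha>(a) (\<alpha>(b) - b)\<close>. Since \<open>\<alpha>\<^sub>S - id\<close> has the data
  \<open>(e, \<mu>) = (w, \<epsilon> - 1)\<close>, the conditions (a), (b), (c) become (i), (ii), (iii), and
  \<open>\<epsilon>\<mu> = 0\<close> says that \<open>\<epsilon>\<close> is idempotent.
\<close>

lemma module_hom_hext_endo:
  fixes smul :: "'k::comm_ring_1 \<Rightarrow> 'r::ring \<Rightarrow> 'r"
  assumes "module_hom smul smul f"
  shows "module_hom (hext_scale smul) (hext_scale smul) (hext_endo smul f u \<nu>)"
proof -
  interpret f: module_hom smul smul f by fact
  note scale = module_prod.scale_prod[OF module_prod_times[OF f.m1.module_axioms]]
  have "module (hext_scale smul)"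
  proof -
    interpret P: module_prod smul "(*) :: 'k \<Rightarrow> 'k \<Rightarrow> 'k"
      by (rule module_prod_times) (rule f.m1.module_axioms)
    show ?thesis by (rule P.p.module_axioms)
  qed
  then show ?thesis
  proof (intro module_hom.intro module_hom_axioms.intro)
    fix x y :: "'r \<times> 'k" and c :: 'k
    show "hext_endo smul f u \<nu> (x + y) = hext_endo smul f u \<nu> x + hext_endo smul f u \<nu> y"
      by (cases x; cases y)
        (simp add: hext_endo_def f.add algebra_simps)
    show "hext_endo smul f u \<nu> (hext_scale smul c x) = hext_scale smul c (hext_endo smul f u \<nu> x)"
      by (cases x)
        (simp add: hext_endo_def scale f.scale
          f.m1.scale_right_distrib mult.assoc)
  qed
qed

lemma hext_endo_comp_embed:
  assumes "module (smul :: 'k::comm_ring_1 \<Rightarrow> 'r::ring \<Rightarrow> 'r)"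
  shows "hext_endo smul f u \<nu> \<circ> hext_embed = hext_embed \<circ> f"
proof -
  interpret module smul by fact
  show ?thesis by (auto simp: fun_eq_iff hext_endo_def hext_embed_def)
qed

text \<open>
  Every element decomposes as \<open>(a, \<xi>) = (a, 0) + \<xi> \<cdot> (0, 1)\<close>, so the value at \<open>(0, 1)\<close> is the only
  freedom in a linear extension of \<open>f\<close>.
\<close>

lemma linear_extension_eq_hext_endo:
  fixes smul :: "'k::comm_ring_1 \<Rightarrow> 'r::ring \<Rightarrow> 'r"
  assumes "module smul"
    and hom: "module_hom (hext_scale smul) (hext_scale smul) g"
    and ext: "g \<circ> hext_embed = hext_embed \<circ> f"
  obtains u \<nu> where "g = hext_endo smul f u \<nu>"
proof -
  interpret module smul by fact
  interpret g: module_hom "hext_scale smul" "hext_scale smul" g by fact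
  note scale = module_prod.scale_prod[OF module_prod_times[OF module_axioms]]
  obtain u \<nu> where gen: "g (0, 1) = (u, \<nu>)" by (metis surj_pair)
  have "g (a, \<xi>) = hext_endo smul f u \<nu> (a, \<xi>)" for a \<xi>
  proof -
    have "(a, \<xi>) = (a, 0) + hext_scale smul \<xi> (0, 1)"
      by (simp add: scale)
    then have "g (a, \<xi>) = g (a, 0) + hext_scale smul \<xi> (g (0, 1))"
      by (simp only: g.add g.scale)
    moreover have "g (a, 0) = (f a, 0)"
      using ext by (simp add: fun_eq_iff hext_embed_def)
    ultimately show ?thesis
      by (simp add: gen scale hext_endo_def)
  qed
  then have "g = hext_endo smul f u \<nu>" by auto
  then show thesis by (rule that)
qed

text \<open>
  Each condition on the right is the rule for one kind of product of generators: \<open>\<sigma>\<sigma>\<close> gives the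
  first two, \<open>a\<sigma>\<close> and \<open>\<sigma>a\<close> the others. Conversely, these conditions and the rule in \<open>R\<close> give the
  rule for all \<open>x\<close> and \<open>y\<close> by bilinearity. The only term in the way is \<open>\<xi>\<zeta>\<epsilon>\<mu> (s + \<sigma>)\<close>, from the
  product of the scalar parts of \<open>\<alpha>\<^sub>S x\<close> and \<open>\<delta>\<^sub>S y\<close>, and it vanishes with \<open>\<epsilon>\<mu>\<close>. The map \<open>\<alpha>\<close> is
  only assumed linear, so that the lemma can serve to prove that \<open>\<alpha>\<^sub>S\<close> is multiplicative.
\<close>

lemma hext_skew_Leibniz_iff:
  fixes smul :: "'k::comm_ring_1 \<Rightarrow> 'r::ring \<Rightarrow> 'r"
  assumes alg: "nonunital_algebra smul ((*) :: 'r \<Rightarrow> 'r \<Rightarrow> 'r)"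
    and op: "double_operator smul \<sigma>"
    and \<alpha>: "module_hom smul smul \<alpha>" and \<delta>: "module_hom smul smul \<delta>"
    and Leibniz: "\<And>a b. \<delta> (a * b) = \<delta> a * b + \<alpha> a * \<delta> b"
  shows "(\<forall>x y. hext_endo smul \<delta> e \<mu> (hext_mult smul \<sigma> s x y) =
            hext_mult smul \<sigma> s (hext_endo smul \<delta> e \<mu> x) y +
            hext_mult smul \<sigma> s (hext_endo smul \<alpha> w \<epsilon> x) (hext_endo smul \<delta> e \<mu> y)) \<longleftrightarrow>
         \<epsilon> * \<mu> = 0 \<and>
         \<delta> s - smul \<mu> s = e \<lhd> \<sigma> + smul \<epsilon> (\<sigma> \<rhd> e) + w * e + smul \<mu> (w \<lhd> \<sigma>) - e \<and>
         (\<forall>a. \<delta> (a \<lhd> \<sigma>) = \<delta> a \<lhd> \<sigma> + \<alpha> a * e + smul \<mu> (\<alpha> a \<lhd> \<sigma>)) \<and>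
         (\<forall>a. \<delta> (\<sigma> \<rhd> a) = w * \<delta> a + smul \<epsilon> (\<sigma> \<rhd> \<delta> a) + e * a + smul \<mu> (\<sigma> \<rhd> a))"
    (is "(\<forall>x y. ?D (?m x y) = ?m (?D x) y + ?m (?A x) (?D y)) \<longleftrightarrow> ?unit \<and> ?a \<and> ?b \<and> ?c")
proof -
  interpret A: nonunital_algebra smul "(*)" by fact
  interpret r: module_hom smul smul "fst \<sigma>" using op by (simp add: double_operator_def)
  interpret l: module_hom smul smul "snd \<sigma>" using op by (simp add: double_operator_def)
  interpret \<alpha>: module_hom smul smul \<alpha> by fact
  interpret \<delta>: module_hom smul smul \<delta> by fact
  note defs = hext_endo_def hext_mult_def
  show ?thesis
  proof
    assume L: "\<forall>x y. ?D (?m x y) = ?m (?D x) y + ?m (?A x) (?D y)"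
    have \<sigma>\<sigma>: "?unit" "\<delta> s + e =
        e \<lhd> \<sigma> + smul \<mu> s + (w * e + smul \<mu> (w \<lhd> \<sigma>) + smul \<epsilon> (\<sigma> \<rhd> e) + smul (\<epsilon> * \<mu>) s)"
      using L[rule_format, of "(0, 1)" "(0, 1)"]
      by (simp_all add: defs)
    have ?a using \<sigma>\<sigma> by (simp add: algebra_simps)
    moreover have ?b
    proof
      fix a
      show "\<delta> (a \<lhd> \<sigma>) = \<delta> a \<lhd> \<sigma> + \<alpha> a * e + smul \<mu> (\<alpha> a \<lhd> \<sigma>)"
        using L[rule_format, of "(a, 0)" "(0, 1)"]
        by (simp add: defs ac_simps)
    qed
    moreover have ?c
    proof
      fix a
      show "\<delta> (\<sigma> \<rhd> a) = w * \<delta> a + smul \<epsilon> (\<sigma> \<rhd> \<delta> a) + e * a + smul \<mu> (\<sigma> \<rhd> a)"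
        using L[rule_format, of "(0, 1)" "(a, 0)"]
        by (simp add: defs ac_simps)
    qed
    ultimately show "?unit \<and> ?a \<and> ?b \<and> ?c" using \<sigma>\<sigma>(1) by simp
  next
    assume R: "?unit \<and> ?a \<and> ?b \<and> ?c"
    \<comment> \<open>Additive form of (a): without subtraction the two sides can be compared summand by summand.\<close>
    have a: "\<delta> s + e = smul \<mu> s + (e \<lhd> \<sigma> + smul \<epsilon> (\<sigma> \<rhd> e) + w * e + smul \<mu> (w \<lhd> \<sigma>))"
      using R by (simp add: algebra_simps)
    have b: "\<delta> (a \<lhd> \<sigma>) = \<delta> a \<lhd> \<sigma> + \<alpha> a * e + smul \<mu> (\<alpha> a \<lhd> \<sigma>)"
      and c: "\<delta> (\<sigma> \<rhd> a) = w * \<delta> a + smul \<epsilon> (\<sigma> \<rhd> \<delta> a) + e * a + smul \<mu> (\<sigma> \<rhd> a)" for a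
      using R by auto
    note expand = \<delta>.add \<delta>.scale r.add r.scale l.add l.scale Leibniz b c
      A.scale_right_distrib A.scale_left_distrib A.mult_scale_left A.mult_scale_right
      distrib_left distrib_right A.scale_scale
    show "\<forall>x y. ?D (?m x y) = ?m (?D x) y + ?m (?A x) (?D y)"
    proof (intro allI)
      fix x y :: "'r \<times> 'k"
      obtain a \<xi> b \<zeta> where xy: "x = (a, \<xi>)" "y = (b, \<zeta>)" by (metis surj_pair)
      have "\<xi> * \<epsilon> * (\<zeta> * \<mu>) = \<xi> * \<zeta> * (\<epsilon> * \<mu>)" by (simp only: ac_simps)
      with R have unit: "\<xi> * \<epsilon> * (\<zeta> * \<mu>) = 0" by simp
      have "\<delta> (a * b + smul \<zeta> (a \<lhd> \<sigma>) + smul \<xi> (\<sigma> \<rhd> b) + smul (\<xi> * \<zeta>) s) + smul (\<xi> * \<zeta>) e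
          = \<delta> (a * b) + smul \<zeta> (\<delta> (a \<lhd> \<sigma>)) + smul \<xi> (\<delta> (\<sigma> \<rhd> b)) + smul (\<xi> * \<zeta>) (\<delta> s + e)"
        by (simp only: \<delta>.add \<delta>.scale A.scale_right_distrib add.assoc)
      also have "\<dots> = (\<delta> a + smul \<xi> e) * b + smul \<zeta> ((\<delta> a + smul \<xi> e) \<lhd> \<sigma>)
            + smul (\<xi> * \<mu>) (\<sigma> \<rhd> b) + smul (\<xi> * \<mu> * \<zeta>) s
          + ((\<alpha> a + smul \<xi> w) * (\<delta> b + smul \<zeta> e) + smul (\<zeta> * \<mu>) ((\<alpha> a + smul \<xi> w) \<lhd> \<sigma>)
            + smul (\<xi> * \<epsilon>) (\<sigma> \<rhd> (\<delta> b + smul \<zeta> e)))"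
        unfolding a by (simp only: expand ac_simps)
      finally show "?D (?m x y) = ?m (?D x) y + ?m (?A x) (?D y)"
        unfolding xy defs prod.case add_Pair unit A.scale_zero_left by (simp add: ac_simps)
    qed
  qed
qed

text \<open>
  Obtained from the previous lemma with \<open>\<delta> = \<alpha> - id\<close>, \<open>e = w\<close> and \<open>\<mu> = \<epsilon> - 1\<close>: the
  \<open>\<alpha>\<^sub>S\<close>-skew Leibniz rule for \<open>\<alpha>\<^sub>S - id\<close> is the multiplicativity of \<open>\<alpha>\<^sub>S\<close>.
\<close>

lemma algebra_endomorphism_hext_endo:
  fixes smul :: "'k::comm_ring_1 \<Rightarrow> 'r::ring \<Rightarrow> 'r"
  assumes datum: "homothetic_datum smul \<sigma> s"
    and endo: "algebra_endomorphism smul (*) \<alpha>"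
    and idem: "\<epsilon> * \<epsilon> = \<epsilon>"
    and s: "\<alpha> s - smul \<epsilon> s = w * w + smul \<epsilon> (w \<lhd> \<sigma>) + smul \<epsilon> (\<sigma> \<rhd> w) - w"
    and r: "\<And>a. \<alpha> (a \<lhd> \<sigma>) = smul \<epsilon> (\<alpha> a \<lhd> \<sigma>) + \<alpha> a * w"
    and l: "\<And>a. \<alpha> (\<sigma> \<rhd> a) = smul \<epsilon> (\<sigma> \<rhd> \<alpha> a) + w * \<alpha> a"
  shows "algebra_endomorphism (hext_scale smul) (hext_mult smul \<sigma> s) (hext_endo smul \<alpha> w \<epsilon>)"
proof -
  interpret \<alpha>: algebra_endomorphism smul "(*)" \<alpha> by fact
  have op: "double_operator smul \<sigma>"
    using datum by (simp add: homothetic_datum_def double_homothetism_def bimultiplication_def)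
  interpret r: module_hom smul smul "fst \<sigma>" using op by (simp add: double_operator_def)
  interpret l: module_hom smul smul "snd \<sigma>" using op by (simp add: double_operator_def)
  interpret S: nonunital_algebra "hext_scale smul" "hext_mult smul \<sigma> s"
    by (rule hext_nonunital_algebra[OF \<alpha>.nonunital_algebra_axioms datum])
  let ?m = "hext_mult smul \<sigma> s" and ?A = "hext_endo smul \<alpha> w \<epsilon>"
  let ?d = "\<lambda>a. \<alpha> a - a" and ?D = "hext_endo smul (\<lambda>a. \<alpha> a - a) w (\<epsilon> - 1)"
  have lin: "module_hom smul smul ?d"
    by unfold_locales (simp_all add: \<alpha>.add \<alpha>.scale algebra_simps)
  have Leibniz: "?d (a * b) = ?d a * b + \<alpha> a * ?d b" for a b
    by (simp add: \<alpha>.hom_mult algebra_simps)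
  have Leibniz_D: "\<forall>x y. ?D (?m x y) = ?m (?D x) y + ?m (?A x) (?D y)"
    unfolding hext_skew_Leibniz_iff[OF \<alpha>.nonunital_algebra_axioms op \<alpha>.module_hom_axioms
        lin Leibniz]
    using idem s by (simp add: r l r.diff l.diff algebra_simps)
  have D: "?D x = ?A x - x" for x
    by (cases x) (simp add: hext_endo_def algebra_simps)
  have Leibniz_S: "?A (?m x y) - ?m x y = ?m (?A x - x) y + ?m (?A x) (?A y - y)" for x y
    using Leibniz_D[rule_format, of x y] unfolding D .
  have "?A (?m x y) = ?m (?A x) (?A y)" for x y
  proof -
    have "?m (?A x - x) y = ?m (?A x) y - ?m x y"
      using S.mult_add_left[of "?A x - x" x y] by (simp add: eq_diff_eq)
    moreover have "?m (?A x) (?A y - y) = ?m (?A x) (?A y) - ?m (?A x) y"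
      using S.mult_add_right[of "?A x" "?A y - y" y] by (simp add: eq_diff_eq)
    ultimately show ?thesis
      using Leibniz_S[of x y] by simp
  qed
  then show ?thesis
    using S.nonunital_algebra_axioms module_hom_hext_endo[OF \<alpha>.module_hom_axioms]
    by (simp add: algebra_endomorphism_def algebra_endomorphism_axioms_def)
qed

theorem proposition2p5:
  fixes smul :: "'k::comm_ring_1 \<Rightarrow> 'r::ring \<Rightarrow> 'r"
    and \<sigma> :: "'r double_operator"
    and s w :: 'r
    and \<alpha>\<^sub>R \<delta>\<^sub>R :: "'r \<Rightarrow> 'r"
    and \<epsilon> :: 'k
  assumes "field_or_integers TYPE('k)"
    and "nonunital_algebra smul ((*) :: 'r \<Rightarrow> 'r \<Rightarrow> 'r)"
    and "homothetic_datum smul \<sigma> s"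
    and "algebra_endomorphism smul (*) \<alpha>\<^sub>R"
    and "\<epsilon> \<in> {0, 1}"
    and "\<alpha>\<^sub>R s - smul \<epsilon> s = w * w + smul \<epsilon> (w \<lhd> \<sigma>) + smul \<epsilon> (\<sigma> \<rhd> w) - w"
    and "\<And>a. \<alpha>\<^sub>R (a \<lhd> \<sigma>) = smul \<epsilon> (\<alpha>\<^sub>R a \<lhd> \<sigma>) + \<alpha>\<^sub>R a * w"
    and "\<And>a. \<alpha>\<^sub>R (\<sigma> \<rhd> a) = smul \<epsilon> (\<sigma> \<rhd> \<alpha>\<^sub>R a) + w * \<alpha>\<^sub>R a"
    and "skew_derivation smul (*) \<alpha>\<^sub>R \<delta>\<^sub>R"
  shows "algebra_endomorphism (hext_scale smul) (hext_mult smul \<sigma> s)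
           (hext_endo smul \<alpha>\<^sub>R w \<epsilon>)
       \<and> hext_endo smul \<alpha>\<^sub>R w \<epsilon> \<circ> hext_embed = hext_embed \<circ> \<alpha>\<^sub>R
       \<and> ((\<exists>\<delta>\<^sub>S. skew_derivation (hext_scale smul) (hext_mult smul \<sigma> s)
                   (hext_endo smul \<alpha>\<^sub>R w \<epsilon>) \<delta>\<^sub>S
                 \<and> \<delta>\<^sub>S \<circ> hext_embed = hext_embed \<circ> \<delta>\<^sub>R)
          \<longleftrightarrow> (\<exists>e \<mu>. (\<epsilon> = 1 \<longrightarrow> \<mu> = 0)
                 \<and> \<delta>\<^sub>R s - smul \<mu> s
                     = e \<lhd> \<sigma> + smul \<epsilon> (\<sigma> \<rhd> e) + w * e + smul \<mu> (w \<lhd> \<sigma>) - e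
                 \<and> (\<forall>a. \<delta>\<^sub>R (a \<lhd> \<sigma>)
                     = \<delta>\<^sub>R a \<lhd> \<sigma> + \<alpha>\<^sub>R a * e + smul \<mu> (\<alpha>\<^sub>R a \<lhd> \<sigma>))
                 \<and> (\<forall>a. \<delta>\<^sub>R (\<sigma> \<rhd> a)
                     = w * \<delta>\<^sub>R a + smul \<epsilon> (\<sigma> \<rhd> \<delta>\<^sub>R a) + e * a + smul \<mu> (\<sigma> \<rhd> a))))"
proof -
  interpret \<alpha>: algebra_endomorphism smul "(*)" \<alpha>\<^sub>R by fact
  interpret \<delta>: skew_derivation smul "(*)" \<alpha>\<^sub>R \<delta>\<^sub>R by fact
  have op: "double_operator smul \<sigma>"
    using assms(3) by (simp add: homothetic_datum_def double_homothetism_def bimultiplication_def)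
  let ?m = "hext_mult smul \<sigma> s" and ?A = "hext_endo smul \<alpha>\<^sub>R w \<epsilon>"
  have "\<epsilon> * \<epsilon> = \<epsilon>" using assms(5) by auto
  then have endo: "algebra_endomorphism (hext_scale smul) ?m ?A"
    by (rule algebra_endomorphism_hext_endo[where smul = smul and \<sigma> = \<sigma> and s = s
          and \<alpha> = \<alpha>\<^sub>R and w = w and \<epsilon> = \<epsilon>, OF assms(3,4) _ assms(6-8)])
  note extends = hext_endo_comp_embed[OF \<alpha>.module_axioms]
  have unit: "\<epsilon> * \<mu> = 0 \<longleftrightarrow> (\<epsilon> = 1 \<longrightarrow> \<mu> = 0)" for \<mu>
    using assms(5) by auto
  have skew_iff: "skew_derivation (hext_scale smul) ?m ?A (hext_endo smul \<delta>\<^sub>R e \<mu>) \<longleftrightarrow>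
      (\<forall>x y. hext_endo smul \<delta>\<^sub>R e \<mu> (?m x y) =
        ?m (hext_endo smul \<delta>\<^sub>R e \<mu> x) y + ?m (?A x) (hext_endo smul \<delta>\<^sub>R e \<mu> y))" for e \<mu>
    using endo module_hom_hext_endo[OF \<delta>.\<delta>.module_hom_axioms]
    by (simp add: skew_derivation_def skew_derivation_axioms_def)
  note conditions = skew_iff[unfolded hext_skew_Leibniz_iff[OF assms(2) op \<alpha>.module_hom_axioms
        \<delta>.\<delta>.module_hom_axioms \<delta>.skew_Leibniz] unit]
  have "(\<exists>\<delta>\<^sub>S. skew_derivation (hext_scale smul) ?m ?A \<delta>\<^sub>S \<and>
          \<delta>\<^sub>S \<circ> hext_embed = hext_embed \<circ> \<delta>\<^sub>R) \<longleftrightarrow>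
      (\<exists>e \<mu>. skew_derivation (hext_scale smul) ?m ?A (hext_endo smul \<delta>\<^sub>R e \<mu>))"
    (is "?ext \<longleftrightarrow> ?data")
  proof
    assume ?ext
    then obtain \<delta>\<^sub>S where skew: "skew_derivation (hext_scale smul) ?m ?A \<delta>\<^sub>S"
      and ext: "\<delta>\<^sub>S \<circ> hext_embed = hext_embed \<circ> \<delta>\<^sub>R" by blast
    have "module_hom (hext_scale smul) (hext_scale smul) \<delta>\<^sub>S"
      using skew by (simp add: skew_derivation_def)
    then obtain e \<mu> where "\<delta>\<^sub>S = hext_endo smul \<delta>\<^sub>R e \<mu>"
      using linear_extension_eq_hext_endo[OF \<alpha>.module_axioms _ ext] by blast
    then show ?data using skew by blast
  next
    assume ?data
    then show ?ext using extends by blast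
  qed
  then show ?thesis
    using endo extends unfolding conditions by simp
qed

end
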